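(* Let $G=(V,E)$ be a water distribution system with reservoir nodes $V_{\mathrm r}$ and consumer nodes $V_{\mathrm c}$, and let $h=(h_v)_{v\in V}\in\mathbb{R}^{V}$ be given (reservoir and consumer) heads. Then there exists exactly one pair $(q,d)$ of flows $q\in\mathbb{R}^{E}$ and demands $d\in\mathbb{R}^{V_{\mathrm c}}$ such that the triple $(h,q,d)$ is physically correct.
   Context: A water distribution system (WDS) is a finite, connected, symmetric directed graph $G=(V,E)$ with $V\neq\emptyset$, $E\neq\emptyset$, whose edges are ordered pairs of distinct nodes; $e_{vu}=(v,u)$ denotes the edge from $v$ to $u$, and symmetric means $e_{vu}\in E$ implies $e_{uv}\in E$. The node set is a disjoint union $V=V_{\mathrm r}\sqcup V_{\mathrm c}$ of a nonempty set $V_{\mathrm r}$ of reservoir nodes and a nonempty set $V_{\mathrm c}$ of consumer nodes. The neighborhood of $v$ is $\mathcal N(v)=\{u\in V: e_{vu}\in E \text{ or } e_{uv}\in E\}$. Each edge carries a resistance coefficient $r_{vu}=10.67\, l_{vu}\,\rho_{vu}^{-4.8704}\,\eta_{vu}^{-1.852}>0$, where the length $l_{vu}=l_{uv}>0$, diameter $\rho_{vu}=\rho_{uv}>0$ and roughness $\eta_{vu}=\eta_{uv}>0$ are symmetric (so $r_{vu}=r_{uv}$), and $x=1.852$. A hydraulic state is a triple $(h,q,d)$ of heads $h=(h_v)_{v\in V}$, flows $q=(q_e)_{e\in E}$ (write $q_{vu}=q_{e_{vu}}$) and demands $d=(d_v)_{v\in V_{\mathrm c}}$; all entries are real numbers.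 It is called physically correct if and only if the following three conditions hold: (1) conservation of energy: $h_v-h_u=r_{vu}\,q_{vu}\,|q_{vu}|^{x-1}$ for all $v\in V$, $u\in\mathcal N(v)$; (2) conservation of mass: $\sum_{u\in\mathcal N(v)}q_{vu}=-d_v$ for all $v\in V_{\mathrm c}$; (3) conservation of flows: $q_{uv}=-q_{vu}$ for all $v\in V$, $u\in\mathcal N(v)$. *)

theory Defs
  imports
    Complex_Main
    "HOL-Library.FuncSet"
    "Graph_Theory.Graph_Theory"
begin

text \<open>
  An edge from \<open>v\<close> to \<open>u\<close> is the pair \<open>(v, u)\<close>. Real vectors indexed by a finite set \<open>A\<close>
  are elements of \<open>A \<rightarrow>\<^sub>E UNIV\<close>: functions that are \<open>undefined\<close> off \<open>A\<close>, so that equality of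
  functions is equality of vectors.
\<close>

text \<open>
  The locale \<open>pair_graph\<close> provides finite, loop-free, symmetric directed graphs whose edges are
  pairs of nodes. \<open>Digraph_Component.connected\<close> is graph connectedness (not the topological
  notion) and includes non-emptiness of the node set.
\<close>

locale water_distribution_system = pair_graph G
  for G :: "'v pair_pre_digraph" +
  fixes Vr Vc :: "'v set"
    and l \<rho> \<eta> :: "'v \<times> 'v \<Rightarrow> real"
  assumes graph_connected: "Digraph_Component.connected (with_proj G)"
    and nodes_nonempty: "pverts G \<noteq> {}"
    and edges_nonempty: "parcs G \<noteq> {}"
    and nodes_partition: "pverts G = Vr \<union> Vc" "Vr \<inter> Vc = {}"
    and reservoirs_nonempty: "Vr \<noteq> {}"
    and consumers_nonempty: "Vc \<noteq> {}"
    and length_pos: "\<And>v u. (v, u) \<in> parcs G \<Longrightarrow> l (v, u) > 0"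
    and length_sym: "\<And>v u. (v, u) \<in> parcs G \<Longrightarrow> l (v, u) = l (u, v)"
    and diameter_pos: "\<And>v u. (v, u) \<in> parcs G \<Longrightarrow> \<rho> (v, u) > 0"
    and diameter_sym: "\<And>v u. (v, u) \<in> parcs G \<Longrightarrow> \<rho> (v, u) = \<rho> (u, v)"
    and roughness_pos: "\<And>v u. (v, u) \<in> parcs G \<Longrightarrow> \<eta> (v, u) > 0"
    and roughness_sym: "\<And>v u. (v, u) \<in> parcs G \<Longrightarrow> \<eta> (v, u) = \<eta> (u, v)"

definition neighborhood :: "'v pair_pre_digraph \<Rightarrow> 'v \<Rightarrow> 'v set" where
  "neighborhood G v = {u \<in> pverts G. (v, u) \<in> parcs G \<or> (u, v) \<in> parcs G}"

text \<open>The Hazen--Williams exponent and resistance coefficient.\<close>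

definition hw_exponent :: real where
  "hw_exponent = 1.852"

definition resistance ::
    "('v \<times> 'v \<Rightarrow> real) \<Rightarrow> ('v \<times> 'v \<Rightarrow> real) \<Rightarrow> ('v \<times> 'v \<Rightarrow> real) \<Rightarrow> 'v \<times> 'v \<Rightarrow> real" where
  "resistance l \<rho> \<eta> e = 10.67 * l e * \<rho> e powr (- 4.8704) * \<eta> e powr (- 1.852)"

text \<open>
  The arguments \<open>h\<close>, \<open>q\<close>, \<open>d\<close> are heads, flows and demands; \<open>r\<close> is the resistance coefficient.
  For zero flow, \<open>0 powr (hw_exponent - 1) = 0\<close> agrees with the usual value.
\<close>

definition physically_correct ::
    "'v pair_pre_digraph \<Rightarrow> 'v set \<Rightarrow> ('v \<times> 'v \<Rightarrow> real) \<Rightarrow>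
      ('v \<Rightarrow> real) \<Rightarrow> ('v \<times> 'v \<Rightarrow> real) \<Rightarrow> ('v \<Rightarrow> real) \<Rightarrow> bool" where
  "physically_correct G Vc r h q d \<longleftrightarrow>
     (\<forall>v \<in> pverts G. \<forall>u \<in> neighborhood G v.
        h v - h u = r (v, u) * q (v, u) * \<bar>q (v, u)\<bar> powr (hw_exponent - 1)) \<and>
     (\<forall>v \<in> Vc. (\<Sum>u \<in> neighborhood G v. q (v, u)) = - d v) \<and>
     (\<forall>v \<in> pverts G. \<forall>u \<in> neighborhood G v. q (u, v) = - q (v, u))"

end

theory Submission
  imports Defs
begin

text \<open>
  Heads determine everything edge by edge. The head loss along a pipe is
  \<open>r * t * \<bar>t\<bar> powr a\<close> with \<open>r > 0\<close> and \<open>a = hw_exponent - 1 > 0\<close>, an odd bijection of the real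
  line in the flow \<open>t\<close>, so conservation of energy on an edge has exactly one solution
  (\<open>head_loss_eq_iff\<close>). Because the resistances are symmetric and the inverse of the head loss is
  odd, exchanging the two ends of an edge negates this solution, so conservation of flows holds
  automatically. Conservation of mass then just reads off the demand at each consumer.
\<close>

definition flow_of_head_loss :: "real \<Rightarrow> real \<Rightarrow> real \<Rightarrow> real" where
  "flow_of_head_loss a r s = sgn s * (\<bar>s\<bar> / r) powr (1 / (1 + a))"

lemma flow_of_head_loss_minus: "flow_of_head_loss a r (- s) = - flow_of_head_loss a r s"
  by (simp add: flow_of_head_loss_def)

text \<open>
  The head loss has the sign of the flow \<open>t\<close> and absolute value \<open>r * \<bar>t\<bar> powr (1 + a)\<close>; comparing
  signs and absolute values separately inverts it.
\<close>

lemma head_loss_eq_iff: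
  fixes a r s t :: real
  assumes "a > 0" "r > 0"
  shows "s = r * t * \<bar>t\<bar> powr a \<longleftrightarrow> t = flow_of_head_loss a r s"
proof
  assume s: "s = r * t * \<bar>t\<bar> powr a"
  show "t = flow_of_head_loss a r s"
  proof (cases "t = 0")
    case False
    have "\<bar>s\<bar> / r = \<bar>t\<bar> powr (1 + a)"
      using s False assms by (simp add: abs_mult powr_add)
    then have "(\<bar>s\<bar> / r) powr (1 / (1 + a)) = \<bar>t\<bar>"
      using assms by (simp add: powr_powr)
    moreover have "sgn s = sgn t"
      using s False assms by (simp add: sgn_mult)
    ultimately show ?thesis
      by (simp add: flow_of_head_loss_def sgn_mult_abs)
  qed (simp add: s flow_of_head_loss_def)
next
  assume t: "t = flow_of_head_loss a r s"
  show "s = r * t * \<bar>t\<bar> powr a"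
  proof (cases "s = 0")
    case False
    define p where "p = \<bar>s\<bar> / r"
    have p: "p > 0" using False assms by (simp add: p_def)
    have t': "t = sgn s * p powr (1 / (1 + a))"
      by (simp add: t flow_of_head_loss_def p_def)
    have "\<bar>t\<bar> = p powr (1 / (1 + a))"
      using False by (simp add: t' abs_mult abs_sgn_eq)
    then have "t * \<bar>t\<bar> powr a = sgn s * (p powr (1 / (1 + a)) * p powr (a / (1 + a)))"
      by (simp add: t' powr_powr)
    also have "\<dots> = sgn s * p powr (1 / (1 + a) + a / (1 + a))"
      by (simp only: powr_add)
    also have "1 / (1 + a) + a / (1 + a) = 1"
      using assms by (simp add: add_divide_distrib[symmetric])
    also have "sgn s * p powr 1 = s / r"
      using p assms by (simp add: p_def sgn_mult_abs)
    finally show ?thesis using assms by (simp add: mult.assoc)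
  qed (simp add: t flow_of_head_loss_def)
qed

lemma (in water_distribution_system) parcs_sym: "(v, u) \<in> parcs G \<Longrightarrow> (u, v) \<in> parcs G"
  using arcs_symmetric by auto

lemma (in water_distribution_system) mem_neighborhood_iff:
  "u \<in> neighborhood G v \<longleftrightarrow> (v, u) \<in> parcs G"
  unfolding neighborhood_def by (auto dest: parcs_sym in_arcsD2)

lemma (in water_distribution_system) resistance_pos:
  "(v, u) \<in> parcs G \<Longrightarrow> resistance l \<rho> \<eta> (v, u) > 0"
  using length_pos[of v u] diameter_pos[of v u] roughness_pos[of v u]
  by (simp add: resistance_def)

lemma (in water_distribution_system) resistance_sym:
  "(v, u) \<in> parcs G \<Longrightarrow> resistance l \<rho> \<eta> (u, v) = resistance l \<rho> \<eta> (v, u)"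
  using length_sym[of v u] diameter_sym[of v u] roughness_sym[of v u]
  by (simp add: resistance_def)

text \<open>
  This is the system solved for its unknowns: flows in terms of heads, demands in terms of
  flows. Conservation of flows leaves no trace here, as it follows from conservation of energy
  on the edges \<open>(v, u)\<close> and \<open>(u, v)\<close>.
\<close>

lemma (in water_distribution_system) physically_correct_iff:
  "physically_correct G Vc (resistance l \<rho> \<eta>) h q d \<longleftrightarrow>
     (\<forall>(v, u) \<in> parcs G.
        q (v, u) = flow_of_head_loss (hw_exponent - 1) (resistance l \<rho> \<eta> (v, u)) (h v - h u)) \<and>
     (\<forall>v \<in> Vc. d v = - (\<Sum>u \<in> neighborhood G v. q (v, u)))"
  (is "_ \<longleftrightarrow> ?flows \<and> ?demands")
proof -
  have exponent_pos: "hw_exponent - 1 > 0" by (simp add: hw_exponent_def)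
  have nodes_edges: "(\<forall>v \<in> pverts G. \<forall>u \<in> neighborhood G v. P v u) \<longleftrightarrow>
      (\<forall>(v, u) \<in> parcs G. P v u)" for P
    unfolding Ball_def by (auto simp: mem_neighborhood_iff dest: in_arcsD1)
  have energy: "(\<forall>v \<in> pverts G. \<forall>u \<in> neighborhood G v.
      h v - h u = resistance l \<rho> \<eta> (v, u) * q (v, u) * \<bar>q (v, u)\<bar> powr (hw_exponent - 1))
    \<longleftrightarrow> ?flows"
    unfolding nodes_edges
    by (intro ball_cong refl) (auto simp: head_loss_eq_iff[OF exponent_pos resistance_pos])
  have antisym: "q (u, v) = - q (v, u)" if ?flows "(v, u) \<in> parcs G" for v u
  proof -
    let ?f = "flow_of_head_loss (hw_exponent - 1) (resistance l \<rho> \<eta> (v, u))"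
    have "q (u, v) = ?f (h u - h v)"
      using that(1) parcs_sym[OF that(2)] resistance_sym[OF that(2)] by auto
    also have "\<dots> = - ?f (h v - h u)"
      using flow_of_head_loss_minus[of _ _ "h v - h u"] by simp
    also have "?f (h v - h u) = q (v, u)"
      using that by auto
    finally show ?thesis .
  qed
  have mass: "(\<forall>v \<in> Vc. (\<Sum>u \<in> neighborhood G v. q (v, u)) = - d v) \<longleftrightarrow> ?demands"
    by (intro ball_cong refl) linarith
  have flows: "\<forall>v \<in> pverts G. \<forall>u \<in> neighborhood G v. q (u, v) = - q (v, u)" if ?flows
    by (intro ballI antisym[OF that]) (simp add: mem_neighborhood_iff)
  show ?thesis
    unfolding physically_correct_def energy mass using flows by argo
qed

theorem theorem3p19:
  fixes G :: "'v pair_pre_digraph"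
    and Vr Vc :: "'v set"
    and l \<rho> \<eta> :: "'v \<times> 'v \<Rightarrow> real"
    and h :: "'v \<Rightarrow> real"
  assumes "water_distribution_system G Vr Vc l \<rho> \<eta>"
    and "h \<in> pverts G \<rightarrow>\<^sub>E UNIV"
  shows "\<exists>!(q, d). q \<in> parcs G \<rightarrow>\<^sub>E UNIV \<and> d \<in> Vc \<rightarrow>\<^sub>E UNIV \<and>
           physically_correct G Vc (resistance l \<rho> \<eta>) h q d"
proof -
  interpret water_distribution_system G Vr Vc l \<rho> \<eta> by fact
  define Q where "Q = (\<lambda>(v, u) \<in> parcs G.
    flow_of_head_loss (hw_exponent - 1) (resistance l \<rho> \<eta> (v, u)) (h v - h u))"
  define D where "D = (\<lambda>v \<in> Vc. - (\<Sum>u \<in> neighborhood G v. Q (v, u)))"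
  have unique: "q \<in> parcs G \<rightarrow>\<^sub>E UNIV \<and> d \<in> Vc \<rightarrow>\<^sub>E UNIV \<and>
      physically_correct G Vc (resistance l \<rho> \<eta>) h q d \<longleftrightarrow> q = Q \<and> d = D" for q d
  proof
    assume *: "q \<in> parcs G \<rightarrow>\<^sub>E UNIV \<and> d \<in> Vc \<rightarrow>\<^sub>E UNIV \<and>
      physically_correct G Vc (resistance l \<rho> \<eta>) h q d"
    then have q: "q \<in> extensional (parcs G)" and d: "d \<in> extensional Vc"
      and pc: "physically_correct G Vc (resistance l \<rho> \<eta>) h q d"
      by (simp_all add: PiE_def)
    have "q = Q"
    proof (rule extensionalityI[OF q])
      show "q e = Q e" if "e \<in> parcs G" for e
        using that bspec[OF conjunct1[OF pc[unfolded physically_correct_iff]] that]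
        by (cases e) (simp add: Q_def)
    qed (simp add: Q_def)
    moreover have "d = D"
    proof (rule extensionalityI[OF d])
      show "d v = D v" if "v \<in> Vc" for v
        using that bspec[OF conjunct2[OF pc[unfolded physically_correct_iff]] that]
        by (simp add: D_def \<open>q = Q\<close>)
    qed (simp add: D_def)
    ultimately show "q = Q \<and> d = D" ..
  next
    assume "q = Q \<and> d = D"
    moreover have "Q \<in> parcs G \<rightarrow>\<^sub>E UNIV" "D \<in> Vc \<rightarrow>\<^sub>E UNIV"
      by (simp_all add: PiE_def Q_def D_def)
    moreover have "physically_correct G Vc (resistance l \<rho> \<eta>) h Q D"
      unfolding physically_correct_iff by (auto simp: Q_def D_def)
    ultimately show "q \<in> parcs G \<rightarrow>\<^sub>E UNIV \<and> d \<in> Vc \<rightarrow>\<^sub>E UNIV \<and>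
      physically_correct G Vc (resistance l \<rho> \<eta>) h q d"
      by simp
  qed
  show ?thesis
    by (rule ex1I[of _ "(Q, D)"]) (auto simp: unique)
qed

end
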